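(* Let the coupling graph be the complete bipartite graph $K_{M,N}$ with $1\le M<N$ and $n=M+N$, with bipartition classes $L_M$ and $L_N$ of sizes $M$ and $N$, and let $\Gamma=(Q,C)$ be a quantum circuit on $n$ qubits with fixing pattern $\mathcal{F}$. Let $\tau\in\mathbb{S}_n$. Let $\mathcal{F}'$ denote the fixing pattern obtained from $\mathcal{F}$ by replacing any $S\in\mathcal{F}$ with $|S|\ge2$ by $$S_1=\{i\in S:\tau^{-1}(i)\in L_M\}\quad\text{and}\quad S_2=\{i\in S:\tau^{-1}(i)\in L_N\}.$$ Then $B_\tau\cong\mathbb{S}_n(\mathcal{F}')$. Moreover, let $\hat p$ denote the number of pairs $\{i,j\}$ in $\mathcal{F}$ for which $\tau^{-1}(i)\in L_M$ and $\tau^{-1}(j)\in L_N$, let $f_1$ denote the number of elements of the free set that are mapped to $L_M$ by $\tau^{-1}$, and let $f_2=f-f_1$. Then $$|B_\tau|=2^{p-\hat p}\,f_1!\,f_2!.$$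
   Context: Notation: $[n]=\{1,\dots,n\}$; $\mathbb{S}_n$ is the symmetric group on $[n]$; $\tau^{-1}(S)=\{\tau^{-1}(s):s\in S\}$. The vertex set of $K_{M,N}$ is identified with $[n]=L_M\sqcup L_N$; $\mathrm{Aut}(K_{M,N})$ is its automorphism group. Qubits $Q=\{q_1,\dots,q_n\}$ are identified with $[n]$; a gate is a two-element subset of $Q$; a quantum circuit is $\Gamma=(Q,C)$ with $C$ a finite sequence of gates. The gate graph $(Q,U)$ is the undirected graph with vertex set $Q$ and edge set $U=\{g:g\in C\}$. The fixing pattern $\mathcal{F}=\{S_1,\dots,S_l\}$ is the partition of $Q$ whose parts are: each singleton consisting of a qubit in a connected component of $(Q,U)$ of size at least 3; each pair of qubits forming a connected component of size 2 (these are "the pairs" of $\mathcal{F}$; $p$ is their number); and the set of all isolated vertices of $(Q,U)$ (the free set; $f\ge0$ is its size). For a collection $\mathcal{P}$ of disjoint subsets of $[n]$ (empty sets being irrelevant), $\mathbb{S}_n(\mathcal{P})=\{a\in\mathbb{S}_n:a(S)=S\ \forall S\in\mathcal{P}\}$. For $\tau\in\mathbb{S}_n$ (a bijection from locations $[n]$ to qubits $Q$), $B_\tau=\{b\in\mathrm{Aut}(K_{M,N}):b(\tau^{-1}(S_i))=\tau^{-1}(S_i)\ \forall i\in[l]\}$. *)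

theory Defs
  imports "HOL-Algebra.Sym_Groups"
begin

section \<open>Undirected graphs and their automorphisms\<close>

text \<open>An undirected graph is a pair of a vertex set and a set of two-element edges.\<close>

type_synonym 'a ugraph = "'a set \<times> 'a set set"

definition complete_bipartite :: "'a set \<Rightarrow> 'a set \<Rightarrow> 'a ugraph" where
  "complete_bipartite A B = (A \<union> B, {{x, y} | x y. x \<in> A \<and> y \<in> B})"

text \<open>Automorphisms are permutations that are the identity outside the vertex set, so that
  equality of functions is equality of automorphisms.\<close>

definition Aut :: "'a ugraph \<Rightarrow> ('a \<Rightarrow> 'a) monoid" where
  "Aut G = \<lparr> carrier = {b. b permutes fst G \<and>
       (\<forall>x \<in> fst G. \<forall>y \<in> fst G. {x, y} \<in> snd G \<longleftrightarrow> {b x, b y} \<in> snd G)},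
     mult = (\<circ>), one = id \<rparr>"

definition component_of :: "'a ugraph \<Rightarrow> 'a \<Rightarrow> 'a set" where
  "component_of G q = {r \<in> fst G. (q, r) \<in> {(x, y). {x, y} \<in> snd G}\<^sup>*}"

definition components :: "'a ugraph \<Rightarrow> 'a set set" where
  "components G = component_of G ` fst G"

definition isolated_vertices :: "'a ugraph \<Rightarrow> 'a set" where
  "isolated_vertices G = {q \<in> fst G. \<forall>e \<in> snd G. q \<notin> e}"


section \<open>Quantum circuits and fixing patterns\<close>

type_synonym 'a circuit = "'a set \<times> 'a set list"

definition quantum_circuit :: "'a circuit \<Rightarrow> bool" where
  "quantum_circuit \<Gamma> \<longleftrightarrow> finite (fst \<Gamma>) \<and> (\<forall>g \<in> set (snd \<Gamma>). g \<subseteq> fst \<Gamma> \<and> card g = 2)"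

definition gate_graph :: "'a circuit \<Rightarrow> 'a ugraph" where
  "gate_graph \<Gamma> = (fst \<Gamma>, set (snd \<Gamma>))"

text \<open>A free set of size 2 is a two-element part of the fixing pattern, but it is not one of
  its pairs: those are the gate-graph components of size 2.\<close>

definition pairs :: "'a circuit \<Rightarrow> 'a set set" where
  "pairs \<Gamma> = {S \<in> components (gate_graph \<Gamma>). card S = 2}"

definition free_set :: "'a circuit \<Rightarrow> 'a set" where
  "free_set \<Gamma> = isolated_vertices (gate_graph \<Gamma>)"

text \<open>The empty set is removed for the case in which there are no isolated vertices.\<close>

definition fixing_pattern :: "'a circuit \<Rightarrow> 'a set set" where
  "fixing_pattern \<Gamma> =
     ({{q} | q. q \<in> fst \<Gamma> \<and> card (component_of (gate_graph \<Gamma>) q) \<ge> 3}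
      \<union> pairs \<Gamma> \<union> {free_set \<Gamma>}) - {{}}"

text \<open>The pattern \<open>\<F>'\<close>, where \<open>\<tau>\<close> maps locations to qubits and \<open>A\<close>, \<open>B\<close> are the
  bipartition classes of the locations. It may contain the empty set.\<close>

definition split_pattern ::
    "'a set \<Rightarrow> 'a set \<Rightarrow> ('a \<Rightarrow> 'a) \<Rightarrow> 'a set set \<Rightarrow> 'a set set" where
  "split_pattern A B \<tau> F = {S \<in> F. card S < 2} \<union>
     (\<Union>S \<in> {S \<in> F. card S \<ge> 2}. {{i \<in> S. inv' \<tau> i \<in> A}, {i \<in> S. inv' \<tau> i \<in> B}})"


section \<open>The groups \<open>\<S>\<^sub>n(P)\<close> and \<open>B\<^sub>\<tau>\<close>\<close>

definition sym_group_fixing :: "nat \<Rightarrow> nat set set \<Rightarrow> (nat \<Rightarrow> nat) monoid" where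
  "sym_group_fixing n P =
     (sym_group n) \<lparr> carrier := {a \<in> carrier (sym_group n). \<forall>S \<in> P. a ` S = S} \<rparr>"

definition B_group :: "'a ugraph \<Rightarrow> 'a set set \<Rightarrow> ('a \<Rightarrow> 'a) \<Rightarrow> ('a \<Rightarrow> 'a) monoid" where
  "B_group G F \<tau> =
     (Aut G) \<lparr> carrier := {b \<in> carrier (Aut G). \<forall>S \<in> F. b ` (inv' \<tau> ` S) = inv' \<tau> ` S} \<rparr>"

end

theory Submission
  imports Defs
begin

text \<open>
  An automorphism of \<open>K\<^bsub>M,N\<^esub>\<close> with \<open>M < N\<close> cannot exchange the two classes, so
  \<open>Aut(K\<^bsub>M,N\<^esub>)\<close> consists of the permutations of the locations that fix \<open>L\<^sub>M\<close> and \<open>L\<^sub>N\<close>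
  setwise (\<open>carrier_Aut_complete_bipartite\<close>).  Conjugation by \<open>\<tau>\<close> carries a permutation \<open>b\<close> of the
  locations to the permutation \<open>\<tau> \<circ> b \<circ> \<tau>\<^sup>-\<^sup>1\<close> of the qubits.  Under it, \<open>b\<close> fixes the classes and
  all the sets \<open>\<tau>\<^sup>-\<^sup>1(S)\<close> exactly when its image fixes \<open>\<tau>(L\<^sub>M)\<close>, \<open>\<tau>(L\<^sub>N)\<close> and all parts \<open>S\<close> of the
  fixing pattern.  As the parts cover the qubits, this means fixing every intersection
  \<open>S \<inter> \<tau>(L\<^sub>M)\<close> and \<open>S \<inter> \<tau>(L\<^sub>N)\<close> (\<open>fixes_halves_iff\<close>), which is what \<open>\<F>'\<close> demands
  (\<open>fixes_split_pattern_iff\<close>).  So conjugation is the isomorphism (\<open>iso_conjugation\<close>).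

  For the order, these intersections are disjoint and cover the qubits, so a permutation that fixes
  them is an independent choice of a permutation on each, and the order is the product of the
  factorials of their sizes (\<open>card_permutations_fixing_blocks\<close>).  A singleton contributes 1, a pair
  contributes 2 or 1 according to whether it lies within one class or is separated by them, and the
  free set contributes \<open>f\<^sub>1! f\<^sub>2!\<close> (\<open>prod_fixing_pattern\<close>, \<open>prod_pairs\<close>).
\<close>


section \<open>Permutations that fix the parts of a partition\<close>

lemma image_Diff_eq_if_permutes:
  assumes "p permutes X" and "p ` A = A"
  shows "p ` (X - A) = X - A"
  using assms by (simp add: image_set_diff permutes_inj permutes_image)

text \<open>Restriction to \<open>A\<close> and to \<open>X\<close> splits off one block; composition puts the two pieces back
  together, as each moves only the points that the other fixes.\<close>

lemma bij_betw_restrict_disjoint_Un: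
  assumes disj: "A \<inter> X = {}" and sub: "\<And>i. i \<in> I \<Longrightarrow> S i \<subseteq> X"
  shows "bij_betw (\<lambda>p. (restrict_id p A, restrict_id p X))
           {p. p permutes (A \<union> X) \<and> p ` A = A \<and> (\<forall>i\<in>I. p ` S i = S i)}
           ({p. p permutes A} \<times> {p. p permutes X \<and> (\<forall>i\<in>I. p ` S i = S i)})"
    (is "bij_betw ?f ?P ?Q")
proof (rule bij_betw_byWitness[where f' = "\<lambda>(q, r). q \<circ> r"])
  have perm: "restrict_id p A permutes A \<and> restrict_id p X permutes X" if "p \<in> ?P" for p
  proof -
    have X: "X = (A \<union> X) - A" using disj by auto
    have "p ` X = X"
      using image_Diff_eq_if_permutes[of p "A \<union> X" A] that X by simp
    then show ?thesis
      using that by (auto intro!: permutes_restrict_id bij_betw_imageI intro: permutes_inj_on)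
  qed
  have fix_r: "r x = x" if "r permutes X" "x \<in> A" for r x
    using that disj by (auto intro: permutes_not_in)
  have fix_q: "q x = x" if "q permutes A" "x \<in> X" for q x
    using that disj by (auto intro: permutes_not_in)
  show "\<forall>p\<in>?P. (\<lambda>(q, r). q \<circ> r) (?f p) = p"
  proof
    fix p assume p: "p \<in> ?P"
    show "(\<lambda>(q, r). q \<circ> r) (?f p) = p"
    proof
      fix x
      have "p x \<in> X" if "x \<in> X"
        using perm[OF p] that permutes_in_image[of "restrict_id p X" X x] by (simp add: restrict_id_def)
      moreover have "p x = x" if "x \<notin> A \<union> X"
        using p that by (auto intro: permutes_not_in)
      ultimately show "(\<lambda>(q, r). q \<circ> r) (?f p) x = p x"
        using disj by (auto simp: restrict_id_def)
    qed
  qed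
  show "\<forall>y\<in>?Q. ?f ((\<lambda>(q, r). q \<circ> r) y) = y"
  proof
    fix y assume "y \<in> ?Q"
    then obtain q r where y: "y = (q, r)" "q permutes A" "r permutes X" by auto
    have "restrict_id (q \<circ> r) A = q"
      using fix_r[OF y(3)] permutes_not_in[OF y(2)] by (auto simp: restrict_id_def fun_eq_iff)
    moreover have "restrict_id (q \<circ> r) X = r"
      using fix_q[OF y(2)] permutes_not_in[OF y(3)] permutes_in_image[OF y(3)]
      by (auto simp: restrict_id_def fun_eq_iff)
    ultimately show "?f ((\<lambda>(q, r). q \<circ> r) y) = y" using y by simp
  qed
  show "?f ` ?P \<subseteq> ?Q"
  proof
    fix y assume "y \<in> ?f ` ?P"
    then obtain p where p: "p \<in> ?P" "y = ?f p" by auto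
    have "restrict_id p X ` S i = S i" if "i \<in> I" for i
    proof -
      have "restrict_id p X ` S i = p ` S i"
        using sub[OF that] by (auto simp: restrict_id_def intro!: image_cong)
      then show ?thesis using p that by simp
    qed
    then show "y \<in> ?Q" using perm[OF p(1)] p by auto
  qed
  show "(\<lambda>(q, r). q \<circ> r) ` ?Q \<subseteq> ?P"
  proof
    fix p assume "p \<in> (\<lambda>(q, r). q \<circ> r) ` ?Q"
    then obtain q r where p: "p = q \<circ> r" "q permutes A" "r permutes X" "\<forall>i\<in>I. r ` S i = S i"
      by auto
    have "p permutes A \<union> X"
      unfolding p using p by (intro permutes_compose) (auto intro: permutes_subset)
    moreover have "r ` A = A" using fix_r[OF p(3)] by (auto simp: image_iff)
    then have "p ` A = A" unfolding p image_comp[symmetric] using p by (simp add: permutes_image)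
    moreover have "p ` S i = S i" if "i \<in> I" for i
    proof -
      have "q ` S i = S i" using fix_q[OF p(2)] sub[OF that] by (auto simp: image_iff subset_iff)
      then show ?thesis unfolding p image_comp[symmetric] using p that by simp
    qed
    ultimately show "p \<in> ?P" by auto
  qed
qed

text \<open>A permutation that fixes every block setwise is an independent choice of a permutation of
  each block.  The blocks form an indexed family rather than a set, because the intersections with
  bipartition classes may be empty, and so may coincide.\<close>

lemma card_permutations_fixing_blocks:
  assumes "finite I" and "\<And>i. i \<in> I \<Longrightarrow> finite (S i)" and "disjoint_family_on S I"
  shows "card {p. p permutes (\<Union>i\<in>I. S i) \<and> (\<forall>i\<in>I. p ` S i = S i)}
       = (\<Prod>i\<in>I. fact (card (S i)))"
  using assms
proof (induction I rule: finite_induct)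
  case empty
  have "{p :: 'a \<Rightarrow> 'a. p = id} = {id}" by auto
  then show ?case by simp
next
  case (insert i I)
  have disj: "S i \<inter> (\<Union>j\<in>I. S j) = {}"
    using insert.prems(2) insert.hyps(2) by (fastforce simp: disjoint_family_on_def)
  have "disjoint_family_on S I"
    using insert.prems(2) by (auto simp: disjoint_family_on_def)
  then have IH: "card {p. p permutes (\<Union>j\<in>I. S j) \<and> (\<forall>j\<in>I. p ` S j = S j)}
       = (\<Prod>j\<in>I. fact (card (S j)))"
    using insert by simp
  have "card {p. p permutes (S i \<union> (\<Union>j\<in>I. S j)) \<and> p ` S i = S i \<and> (\<forall>j\<in>I. p ` S j = S j)}
      = card ({p. p permutes S i} \<times> {p. p permutes (\<Union>j\<in>I. S j) \<and> (\<forall>j\<in>I. p ` S j = S j)})"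
    by (rule bij_betw_same_card[OF bij_betw_restrict_disjoint_Un[OF disj]]) auto
  also have "\<dots> = fact (card (S i)) * (\<Prod>j\<in>I. fact (card (S j)))"
    unfolding card_cartesian_product IH using insert.prems(1) by (simp add: card_permutations)
  finally show ?case using insert.hyps by simp
qed

lemma card_permutations_fixing_common_refinement:
  assumes fin: "finite X" and cover: "\<Union>F = X" and disj: "pairwise disjnt F"
    and AB: "A \<union> B = X" "A \<inter> B = {}" and ne: "A \<noteq> {}"
  shows "card {p. p permutes X \<and> (\<forall>S\<in>F. p ` (S \<inter> A) = S \<inter> A \<and> p ` (S \<inter> B) = S \<inter> B)}
       = (\<Prod>S\<in>F. fact (card (S \<inter> A)) * fact (card (S \<inter> B)))"
proof -
  have "A \<noteq> B" using AB ne by auto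
  have finF: "finite F" using fin cover by (metis finite_UnionD)
  have blocks: "(\<Union>(S, C)\<in>F \<times> {A, B}. S \<inter> C) = X"
    unfolding cover[symmetric] using AB[unfolded cover[symmetric]] by blast
  have "card {p. p permutes X \<and> (\<forall>S\<in>F. p ` (S \<inter> A) = S \<inter> A \<and> p ` (S \<inter> B) = S \<inter> B)}
      = card {p. p permutes (\<Union>i\<in>F \<times> {A, B}. fst i \<inter> snd i)
               \<and> (\<forall>i\<in>F \<times> {A, B}. p ` (fst i \<inter> snd i) = fst i \<inter> snd i)}"
    using blocks by (intro arg_cong[where f = card] Collect_cong) (auto simp: case_prod_beta)
  also have "\<dots> = (\<Prod>i\<in>F \<times> {A, B}. fact (card (fst i \<inter> snd i)))"
  proof (rule card_permutations_fixing_blocks)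
    show "finite (F \<times> {A, B})" using finF by simp
    show "finite (fst i \<inter> snd i)" if "i \<in> F \<times> {A, B}" for i
      using that fin AB by (auto intro: finite_subset[of _ X])
    have "S \<inter> C \<inter> (T \<inter> D) = {}"
      if "S \<in> F" "T \<in> F" "C \<in> {A, B}" "D \<in> {A, B}" "S \<noteq> T \<or> C \<noteq> D" for S T C D
      using that disj AB(2) unfolding pairwise_def disjnt_def by blast
    then show "disjoint_family_on (\<lambda>i. fst i \<inter> snd i) (F \<times> {A, B})"
      unfolding disjoint_family_on_def by (metis mem_Times_iff prod_eqI)
  qed
  also have "\<dots> = (\<Prod>S\<in>F. \<Prod>C\<in>{A, B}. fact (card (S \<inter> C)))"
    by (simp add: prod.cartesian_product case_prod_beta)
  also have "\<dots> = (\<Prod>S\<in>F. fact (card (S \<inter> A)) * fact (card (S \<inter> B)))"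
    using \<open>A \<noteq> B\<close> by simp
  finally show ?thesis .
qed


section \<open>Automorphisms of complete bipartite graphs\<close>

text \<open>Two vertices lie in the same class exactly when they are not adjacent, so an automorphism
  either preserves the classes or maps each into the other; the latter would inject \<open>B\<close> into the
  smaller class \<open>A\<close>.\<close>

lemma carrier_Aut_complete_bipartite:
  assumes fin: "finite A" "finite B" and disj: "A \<inter> B = {}" and less: "card A < card B"
  shows "carrier (Aut (complete_bipartite A B)) = {b. b permutes (A \<union> B) \<and> b ` A = A \<and> b ` B = B}"
proof -
  have edge: "{x, y} \<in> snd (complete_bipartite A B) \<longleftrightarrow> x \<in> A \<and> y \<in> B \<or> x \<in> B \<and> y \<in> A" for x y
    by (auto simp: complete_bipartite_def doubleton_eq_iff)
  have V: "fst (complete_bipartite A B) = A \<union> B" by (simp add: complete_bipartite_def)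
  show ?thesis
  proof (intro equalityI subsetI)
    fix b assume "b \<in> carrier (Aut (complete_bipartite A B))"
    then have perm: "b permutes (A \<union> B)"
      and adj: "\<And>x y. x \<in> A \<union> B \<Longrightarrow> y \<in> A \<union> B \<Longrightarrow>
        (x \<in> A \<and> y \<in> B \<or> x \<in> B \<and> y \<in> A) = (b x \<in> A \<and> b y \<in> B \<or> b x \<in> B \<and> b y \<in> A)"
      unfolding Aut_def V by (auto simp: edge)
    have im: "b x \<in> A \<union> B" if "x \<in> A \<union> B" for x
      using perm that permutes_in_image[of b "A \<union> B" x] by simp
    have "b x \<in> A" if x: "x \<in> A" for x
    proof (rule ccontr)
      assume "b x \<notin> A"
      then have "b ` B \<subseteq> A"
        using adj[of x] x im disj by blast
      then have "card (b ` B) \<le> card A" using fin(1) by (rule card_mono[rotated])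
      moreover have "card (b ` B) = card B"
        using perm by (intro card_image permutes_inj_on)
      ultimately show False using less by simp
    qed
    then have "b ` A = A"
      using fin(1) perm by (intro endo_inj_surj permutes_inj_on) auto
    moreover have "B = (A \<union> B) - A" using disj by auto
    ultimately have "b ` B = B" using image_Diff_eq_if_permutes[OF perm] by metis
    then show "b \<in> {b. b permutes (A \<union> B) \<and> b ` A = A \<and> b ` B = B}"
      using perm \<open>b ` A = A\<close> by simp
  next
    fix b assume "b \<in> {b. b permutes (A \<union> B) \<and> b ` A = A \<and> b ` B = B}"
    then have perm: "b permutes (A \<union> B)" and "b ` A = A" "b ` B = B" by auto
    then have "b x \<in> A \<longleftrightarrow> x \<in> A" "b x \<in> B \<longleftrightarrow> x \<in> B" for x
      using permutes_inj[OF perm] by (metis inj_image_mem_iff)+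
    then show "b \<in> carrier (Aut (complete_bipartite A B))"
      using perm unfolding Aut_def V by (auto simp: edge)
  qed
qed


section \<open>The fixing pattern is a partition of the qubits\<close>

lemma self_in_component: "q \<in> fst G \<Longrightarrow> q \<in> component_of G q"
  by (simp add: component_of_def)

lemma component_of_eq:
  assumes "r \<in> component_of G q"
  shows "component_of G r = component_of G q"
proof -
  let ?R = "{(x, y). {x, y} \<in> snd G}"
  have "sym (?R\<^sup>*)"
    by (intro sym_rtrancl symI) (auto simp: insert_commute)
  then show ?thesis
    using assms unfolding component_of_def by (auto dest: symD intro: rtrancl_trans)
qed

lemma finite_component: "finite (fst G) \<Longrightarrow> finite (component_of G q)"
  by (simp add: component_of_def)

text \<open>The free set can thus be read off from component sizes, as the other parts of the fixing
  pattern are, so that these sizes decide the kind of part in which a qubit lies.\<close>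

lemma isolated_iff_card_component:
  assumes fin: "finite (fst G)" and edges: "\<And>e. e \<in> snd G \<Longrightarrow> e \<subseteq> fst G \<and> card e = 2"
    and q: "q \<in> fst G"
  shows "q \<in> isolated_vertices G \<longleftrightarrow> card (component_of G q) = 1"
proof
  assume iso: "q \<in> isolated_vertices G"
  have "r = q" if "(q, r) \<in> {(x, y). {x, y} \<in> snd G}\<^sup>*" for r
    using that iso by (cases rule: converse_rtranclE) (auto simp: isolated_vertices_def)
  then have "component_of G q = {q}"
    using q by (auto simp: component_of_def)
  then show "card (component_of G q) = 1" by simp
next
  assume one: "card (component_of G q) = 1"
  show "q \<in> isolated_vertices G"
  proof (rule ccontr)
    assume "q \<notin> isolated_vertices G"
    then obtain e where e: "e \<in> snd G" "q \<in> e" using q by (auto simp: isolated_vertices_def)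
    then obtain r where r: "e = {q, r}" "r \<noteq> q" using edges[OF e(1)]
      by (auto simp: card_2_iff doubleton_eq_iff)
    then have "r \<in> component_of G q"
      using e edges[OF e(1)] by (auto simp: component_of_def)
    then show False
      using one r(2) self_in_component[OF q] by (auto simp: card_1_singleton_iff)
  qed
qed

context
  fixes \<Gamma> :: "'a circuit"
  assumes circuit: "quantum_circuit \<Gamma>"
begin

abbreviation (input) component where
  "component \<equiv> component_of (gate_graph \<Gamma>)"

lemma finite_qubits: "finite (fst \<Gamma>)"
  using circuit by (simp add: quantum_circuit_def)

lemma free_set_eq: "free_set \<Gamma> = {q \<in> fst \<Gamma>. card (component q) = 1}"
proof -
  have "q \<in> free_set \<Gamma> \<longleftrightarrow> card (component q) = 1" if "q \<in> fst \<Gamma>" for q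
    unfolding free_set_def using that circuit
    by (intro isolated_iff_card_component) (auto simp: gate_graph_def quantum_circuit_def)
  moreover have "free_set \<Gamma> \<subseteq> fst \<Gamma>"
    by (auto simp: free_set_def isolated_vertices_def gate_graph_def)
  ultimately show ?thesis by auto
qed

lemma pair_component: "S \<in> pairs \<Gamma> \<Longrightarrow> q \<in> S \<Longrightarrow> component q = S"
  unfolding pairs_def components_def using component_of_eq[of q "gate_graph \<Gamma>"] by blast

lemma pairs_subset: "S \<in> pairs \<Gamma> \<Longrightarrow> S \<subseteq> fst \<Gamma>"
  by (auto simp: pairs_def components_def component_of_def gate_graph_def)

lemma component_cases:
  assumes "q \<in> fst \<Gamma>"
  obtains "card (component q) \<ge> 3" | "component q \<in> pairs \<Gamma>" | "q \<in> free_set \<Gamma>"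
proof -
  have q: "q \<in> fst (gate_graph \<Gamma>)" using assms by (simp add: gate_graph_def)
  have "finite (component q)" using finite_qubits by (simp add: finite_component gate_graph_def)
  then have "card (component q) \<noteq> 0" using self_in_component[OF q] by auto
  then consider "card (component q) \<ge> 3" | "card (component q) = 2" | "card (component q) = 1"
    by linarith
  then show thesis
    by cases (use that q assms in \<open>auto simp: pairs_def components_def free_set_eq\<close>)
qed

text \<open>A part is determined by any qubit in it, through the size of that qubit's component.  This
  is why distinct parts are disjoint.\<close>

lemma fixing_pattern_elements:
  assumes "S \<in> fixing_pattern \<Gamma>" and "q \<in> S"
  shows "q \<in> fst \<Gamma>" and "card (component q) \<ge> 3 \<and> S = {q} \<or>
    card (component q) = 2 \<and> S = component q \<or> card (component q) = 1 \<and> S = free_set \<Gamma>"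
proof -
  consider "S = {q}" "q \<in> fst \<Gamma>" "card (component q) \<ge> 3" | "S \<in> pairs \<Gamma>" | "S = free_set \<Gamma>"
    using assms by (auto simp: fixing_pattern_def)
  then have "q \<in> fst \<Gamma> \<and> (card (component q) \<ge> 3 \<and> S = {q} \<or>
    card (component q) = 2 \<and> S = component q \<or> card (component q) = 1 \<and> S = free_set \<Gamma>)"
  proof cases
    case 2
    then have "component q = S" "card S = 2" "S \<subseteq> fst \<Gamma>"
      using assms(2) pair_component pairs_subset by (auto simp: pairs_def)
    then show ?thesis using assms(2) by auto
  qed (use assms in \<open>auto simp: free_set_eq\<close>)
  then show "q \<in> fst \<Gamma>" and "card (component q) \<ge> 3 \<and> S = {q} \<or>
    card (component q) = 2 \<and> S = component q \<or> card (component q) = 1 \<and> S = free_set \<Gamma>"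
    by auto
qed

lemma Union_fixing_pattern: "\<Union>(fixing_pattern \<Gamma>) = fst \<Gamma>"
proof (intro equalityI subsetI)
  fix q assume "q \<in> fst \<Gamma>"
  then have "q \<in> component q"
    by (intro self_in_component) (simp add: gate_graph_def)
  from \<open>q \<in> fst \<Gamma>\<close> show "q \<in> \<Union>(fixing_pattern \<Gamma>)"
  proof (cases rule: component_cases)
    case 1
    then have "{q} \<in> fixing_pattern \<Gamma>"
      using \<open>q \<in> fst \<Gamma>\<close> by (auto simp: fixing_pattern_def)
    then show ?thesis by blast
  next
    case 2
    then have "component q \<in> fixing_pattern \<Gamma>"
      using \<open>q \<in> component q\<close> by (auto simp: fixing_pattern_def)
    then show ?thesis using \<open>q \<in> component q\<close> by blast
  next
    case 3
    then have "free_set \<Gamma> \<in> fixing_pattern \<Gamma>" by (auto simp: fixing_pattern_def)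
    then show ?thesis using 3 by blast
  qed
qed (use fixing_pattern_elements(1) in auto)

lemma pairwise_disjnt_fixing_pattern: "pairwise disjnt (fixing_pattern \<Gamma>)"
proof -
  have "S = T" if "S \<in> fixing_pattern \<Gamma>" "T \<in> fixing_pattern \<Gamma>" "q \<in> S" "q \<in> T" for S T q
    using fixing_pattern_elements(2)[OF that(1,3)] fixing_pattern_elements(2)[OF that(2,4)]
    by auto
  then show ?thesis unfolding pairwise_def disjnt_def by blast
qed

text \<open>An empty free set is not a part of the pattern; the assumption on the empty set lets its factor
  stand in the product nevertheless.\<close>

lemma prod_fixing_pattern:
  fixes h :: "'a set \<Rightarrow> 'b::comm_monoid_mult"
  assumes sing: "\<And>q. h {q} = 1" and empty: "h {} = 1"
  shows "(\<Prod>S\<in>fixing_pattern \<Gamma>. h S) = (\<Prod>S\<in>pairs \<Gamma>. h S) * h (free_set \<Gamma>)"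
proof -
  let ?K = "{{q} | q. q \<in> fst \<Gamma> \<and> card (component q) \<ge> 3}"
  \<comment> \<open>A free set with two elements is not a pair, so that its factor is not merged with one.\<close>
  have free: "free_set \<Gamma> \<notin> pairs \<Gamma>"
  proof
    assume pair: "free_set \<Gamma> \<in> pairs \<Gamma>"
    then obtain q where q: "q \<in> free_set \<Gamma>" by (auto simp: pairs_def card_2_iff)
    then have "card (free_set \<Gamma>) = 1"
      using pair_component[OF pair q] by (simp add: free_set_eq)
    then show False using pair by (simp add: pairs_def)
  qed
  have fin: "finite (?K \<union> pairs \<Gamma> \<union> {free_set \<Gamma>})"
  proof (rule finite_subset)
    show "?K \<union> pairs \<Gamma> \<union> {free_set \<Gamma>} \<subseteq> Pow (fst \<Gamma>)"
      using pairs_subset by (auto simp: free_set_eq)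
  qed (simp add: finite_qubits)
  have "(\<Prod>S\<in>fixing_pattern \<Gamma>. h S) = (\<Prod>S\<in>insert (free_set \<Gamma>) (pairs \<Gamma>). h S)"
    unfolding fixing_pattern_def by (rule prod.mono_neutral_cong) (use fin sing empty in \<open>auto\<close>)
  also have "\<dots> = (\<Prod>S\<in>pairs \<Gamma>. h S) * h (free_set \<Gamma>)"
    using fin free by (simp add: mult.commute)
  finally show ?thesis .
qed

text \<open>A pair inside one class can be swapped or not; a pair that the classes separate leaves no
  choice.\<close>

lemma prod_pairs:
  assumes AB: "A \<union> B = fst \<Gamma>" "A \<inter> B = {}"
  shows "(\<Prod>S\<in>pairs \<Gamma>. fact (card (S \<inter> A)) * fact (card (S \<inter> B)))
       = (2 :: nat) ^ (card (pairs \<Gamma>) - card {S \<in> pairs \<Gamma>. \<exists>i j. S = {i, j} \<and> i \<in> A \<and> j \<in> B})"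
proof -
  let ?split = "\<lambda>S. \<exists>i j. S = {i, j} \<and> i \<in> A \<and> j \<in> B"
  have fin: "finite (pairs \<Gamma>)"
    using pairs_subset finite_qubits by (auto intro!: finite_subset[of "pairs \<Gamma>" "Pow (fst \<Gamma>)"])
  have factor: "fact (card (S \<inter> A)) * fact (card (S \<inter> B)) = (if ?split S then 1 else 2 :: nat)"
    if S: "S \<in> pairs \<Gamma>" for S
  proof -
    obtain i j where ij: "S = {i, j}" "i \<noteq> j" using S by (auto simp: pairs_def card_2_iff)
    then have cls: "i \<in> A \<and> i \<notin> B \<or> i \<notin> A \<and> i \<in> B" "j \<in> A \<and> j \<notin> B \<or> j \<notin> A \<and> j \<in> B"
      using pairs_subset[OF S] AB by auto
    have "?split S \<longleftrightarrow> (i \<in> A) \<noteq> (j \<in> A)"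
      unfolding ij doubleton_eq_iff using cls by auto
    then show ?thesis using cls ij(2) unfolding ij(1) by auto
  qed
  have "(\<Prod>S\<in>pairs \<Gamma>. fact (card (S \<inter> A)) * fact (card (S \<inter> B)))
      = (\<Prod>S\<in>pairs \<Gamma>. if ?split S then 1 else 2 :: nat)"
    using factor by (rule prod.cong[OF refl])
  also have "\<dots> = 2 ^ card (pairs \<Gamma> \<inter> - {S. ?split S})"
    using fin by (simp add: prod.If_cases)
  also have "pairs \<Gamma> \<inter> - {S. ?split S} = pairs \<Gamma> - {S \<in> pairs \<Gamma>. ?split S}" by auto
  also have "card \<dots> = card (pairs \<Gamma>) - card {S \<in> pairs \<Gamma>. ?split S}"
    using fin by (intro card_Diff_subset) auto
  finally show ?thesis .
qed

end


section \<open>The split pattern and conjugation by \<open>\<tau>\<close>\<close>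

lemma inv_mem_iff_mem_image:
  assumes "bij \<tau>"
  shows "inv' \<tau> i \<in> C \<longleftrightarrow> i \<in> \<tau> ` C"
proof
  assume "inv' \<tau> i \<in> C"
  then show "i \<in> \<tau> ` C"
    using assms by (auto simp: bij_is_surj surj_f_inv_f intro!: image_eqI[of _ _ "inv' \<tau> i"])
qed (use assms in \<open>auto simp: bij_is_inj\<close>)

text \<open>The parts with fewer than two elements need not be cut, since one of their halves is
  empty.\<close>

lemma fixes_split_pattern_iff:
  assumes fin: "finite X" and cover: "\<Union>F = X"
    and \<tau>: "bij \<tau>" and AB: "\<tau> ` A \<union> \<tau> ` B = X" "\<tau> ` A \<inter> \<tau> ` B = {}"
  shows "(\<forall>T\<in>split_pattern A B \<tau> F. a ` T = T)
       \<longleftrightarrow> (\<forall>S\<in>F. a ` (S \<inter> \<tau> ` A) = S \<inter> \<tau> ` A \<and> a ` (S \<inter> \<tau> ` B) = S \<inter> \<tau> ` B)"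
proof -
  have half: "{i \<in> S. inv' \<tau> i \<in> C} = S \<inter> \<tau> ` C" for S C
    using inv_mem_iff_mem_image[OF \<tau>] by auto
  have small: "a ` S = S \<longleftrightarrow> a ` (S \<inter> \<tau> ` A) = S \<inter> \<tau> ` A \<and> a ` (S \<inter> \<tau> ` B) = S \<inter> \<tau> ` B"
    if S: "S \<in> F" "card S < 2" for S
  proof -
    have "finite S" using S cover fin by (meson Sup_upper finite_subset)
    then consider "S = {}" | q where "S = {q}"
      using S(2) by (metis One_nat_def card_0_eq card_1_singletonE less_2_cases)
    then show ?thesis
    proof cases
      case (2 q)
      then have "q \<in> \<tau> ` A \<and> q \<notin> \<tau> ` B \<or> q \<notin> \<tau> ` A \<and> q \<in> \<tau> ` B"
        using S(1) cover AB by blast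
      then have "S \<inter> \<tau> ` A = S \<and> S \<inter> \<tau> ` B = {} \<or> S \<inter> \<tau> ` A = {} \<and> S \<inter> \<tau> ` B = S"
        unfolding 2 by blast
      then show ?thesis by (elim disjE conjE) simp_all
    qed simp
  qed
  have "(\<forall>T\<in>split_pattern A B \<tau> F. a ` T = T) \<longleftrightarrow>
    (\<forall>S\<in>F. if card S < 2 then a ` S = S
            else a ` (S \<inter> \<tau> ` A) = S \<inter> \<tau> ` A \<and> a ` (S \<inter> \<tau> ` B) = S \<inter> \<tau> ` B)"
    unfolding split_pattern_def half by (simp add: ball_Un) (metis not_le)
  then show ?thesis using small by metis
qed

text \<open>A part is the union of its halves, and a class is the union of the halves that it cuts out;
  conversely, a half is an intersection, which images under injective maps respect.\<close>

lemma fixes_halves_iff: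
  assumes "inj a" and cover: "\<Union>F = A \<union> B"
  shows "(\<forall>S\<in>F. a ` (S \<inter> A) = S \<inter> A \<and> a ` (S \<inter> B) = S \<inter> B)
       \<longleftrightarrow> a ` A = A \<and> a ` B = B \<and> (\<forall>S\<in>F. a ` S = S)" (is "?L \<longleftrightarrow> ?R")
proof
  assume L: ?L
  have "a ` S = S" if "S \<in> F" for S
  proof -
    have "S \<inter> A \<union> S \<inter> B = S" using that cover by blast
    then show ?thesis using L that by (metis image_Un)
  qed
  moreover have "a ` C = C" if "C \<in> {A, B}" for C
  proof -
    have "C = (\<Union>S\<in>F. S \<inter> C)" using that cover by blast
    moreover have "a ` (S \<inter> C) = S \<inter> C" if "S \<in> F" for S
      using bspec[OF L that] \<open>C \<in> {A, B}\<close> by (elim insertE emptyE) simp_all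
    ultimately show ?thesis by (metis (no_types, lifting) SUP_cong image_UN)
  qed
  ultimately show ?R by blast
qed (simp add: image_Int[OF \<open>inj a\<close>])

lemma carrier_sym_group_fixing:
  "carrier (sym_group_fixing n P) = {a. a permutes {1..n} \<and> (\<forall>T\<in>P. a ` T = T)}"
  by (simp add: sym_group_fixing_def sym_group_def)

text \<open>Both carriers become sets of permutations that fix the two classes and all parts, once
  with the classes and parts placed among the locations and once among the qubits.\<close>

lemma iso_conjugation:
  assumes \<tau>: "\<tau> permutes {1..n}"
    and AB: "A \<union> B = {1..n}" "A \<inter> B = {}" "card A < card B" and cover: "\<Union>F = {1..n}"
  shows "(\<lambda>b. \<tau> \<circ> b \<circ> inv' \<tau>)
    \<in> iso (B_group (complete_bipartite A B) F \<tau>) (sym_group_fixing n (split_pattern A B \<tau> F))"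
proof -
  let ?h = "\<lambda>b. \<tau> \<circ> b \<circ> inv' \<tau>"
  have fin: "finite A" "finite B" using AB(1) by (metis finite_Un finite_atLeastAtMost)+
  have inv: "inv' \<tau> permutes {1..n}" using \<tau> by (rule permutes_inv)
  have \<tau>_inv: "\<tau> (inv' \<tau> x) = x" "inv' \<tau> (\<tau> x) = x" for x using \<tau> by (simp_all add: permutes_inverses)
  have \<tau>_img: "\<tau> ` A \<union> \<tau> ` B = {1..n}" "\<tau> ` A \<inter> \<tau> ` B = {}"
    using \<tau> AB by (metis image_Un permutes_image, metis image_Int image_empty permutes_inj)
  have carrier_B: "carrier (B_group (complete_bipartite A B) F \<tau>)
    = {b. b permutes {1..n} \<and> b ` A = A \<and> b ` B = B \<and> (\<forall>S\<in>F. b ` (inv' \<tau> ` S) = inv' \<tau> ` S)}"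
    using carrier_Aut_complete_bipartite[OF fin AB(2,3)] AB(1) by (auto simp: B_group_def)
  have carrier_S: "carrier (sym_group_fixing n (split_pattern A B \<tau> F))
    = {a. a permutes {1..n} \<and> a ` (\<tau> ` A) = \<tau> ` A \<and> a ` (\<tau> ` B) = \<tau> ` B \<and> (\<forall>S\<in>F. a ` S = S)}"
    unfolding carrier_sym_group_fixing
    unfolding fixes_split_pattern_iff[OF finite_atLeastAtMost cover permutes_bij[OF \<tau>] \<tau>_img]
    by (intro Collect_cong conj_cong refl fixes_halves_iff) (erule permutes_inj, simp only: cover \<tau>_img)
  have conj: "?h b ` C = C \<longleftrightarrow> b ` (inv' \<tau> ` C) = inv' \<tau> ` C" for b C
  proof -
    have "?h b ` C = C \<longleftrightarrow> \<tau> ` (b ` (inv' \<tau> ` C)) = \<tau> ` (inv' \<tau> ` C)"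
      by (simp add: image_comp comp_def \<tau>_inv)
    then show ?thesis using permutes_inj[OF \<tau>] by (simp add: inj_image_eq_iff)
  qed
  have inv_img: "inv' \<tau> ` (\<tau> ` C) = C" for C by (simp add: image_image \<tau>_inv)
  have "bij_betw ?h (carrier (B_group (complete_bipartite A B) F \<tau>))
    (carrier (sym_group_fixing n (split_pattern A B \<tau> F)))"
    unfolding carrier_B carrier_S
  proof (rule bij_betw_byWitness[where f' = "\<lambda>a. inv' \<tau> \<circ> a \<circ> \<tau>"])
    let ?P = "{b. b permutes {1..n} \<and> b ` A = A \<and> b ` B = B \<and> (\<forall>S\<in>F. b ` (inv' \<tau> ` S) = inv' \<tau> ` S)}"
    let ?Q = "{a. a permutes {1..n} \<and> a ` (\<tau> ` A) = \<tau> ` A \<and> a ` (\<tau> ` B) = \<tau> ` B \<and> (\<forall>S\<in>F. a ` S = S)}"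
    show "\<forall>b\<in>?P. inv' \<tau> \<circ> ?h b \<circ> \<tau> = b" by (simp add: fun_eq_iff \<tau>_inv)
    show "\<forall>a\<in>?Q. ?h (inv' \<tau> \<circ> a \<circ> \<tau>) = a" by (simp add: fun_eq_iff \<tau>_inv)
    show "?h ` ?P \<subseteq> ?Q"
    proof (intro image_subsetI)
      fix b assume b: "b \<in> ?P"
      then have "?h b permutes {1..n}" using \<tau> inv by (intro permutes_compose) auto
      moreover have "?h b ` (\<tau> ` A) = \<tau> ` A \<and> ?h b ` (\<tau> ` B) = \<tau> ` B \<and> (\<forall>S\<in>F. ?h b ` S = S)"
        unfolding conj inv_img using b by simp
      ultimately show "?h b \<in> ?Q" by (intro CollectI conjI) simp_all
    qed
    show "(\<lambda>a. inv' \<tau> \<circ> a \<circ> \<tau>) ` ?Q \<subseteq> ?P"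
    proof (intro image_subsetI)
      fix a assume a: "a \<in> ?Q"
      let ?b = "inv' \<tau> \<circ> a \<circ> \<tau>"
      have "?h ?b = a" by (simp add: fun_eq_iff \<tau>_inv)
      then have fixes_iff: "?b ` (inv' \<tau> ` C) = inv' \<tau> ` C \<longleftrightarrow> a ` C = C" for C
        using conj[of ?b C] by (simp only:)
      have "?b ` A = A \<and> ?b ` B = B \<and> (\<forall>S\<in>F. ?b ` (inv' \<tau> ` S) = inv' \<tau> ` S)"
        unfolding fixes_iff fixes_iff[of "\<tau> ` A", unfolded inv_img]
          fixes_iff[of "\<tau> ` B", unfolded inv_img] using a by simp
      moreover have "?b permutes {1..n}" using a \<tau> inv by (intro permutes_compose) auto
      ultimately show "?b \<in> ?P" by (intro CollectI conjI) simp_all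
    qed
  qed
  moreover have "?h (mult (B_group (complete_bipartite A B) F \<tau>) b c)
      = mult (sym_group_fixing n (split_pattern A B \<tau> F)) (?h b) (?h c)" for b c
    by (simp add: B_group_def Aut_def sym_group_fixing_def sym_group_def fun_eq_iff \<tau>_inv)
  ultimately show ?thesis
    by (intro isoI homI) (rule bij_betw_apply[of ?h], assumption+)
qed


section \<open>The isomorphism and the order\<close>

theorem theorem5p2:
  fixes M N n p p_hat f f1 f2 :: nat
    and L_M L_N :: "nat set"
    and \<Gamma> :: "nat circuit"
    and \<tau> :: "nat \<Rightarrow> nat"
  assumes "1 \<le> M" and "M < N" and "n = M + N"
    and "L_M \<union> L_N = {1..n}" and "L_M \<inter> L_N = {}"
    and "card L_M = M" and "card L_N = N"
    and "quantum_circuit \<Gamma>" and "fst \<Gamma> = {1..n}"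
    and "\<tau> \<in> carrier (sym_group n)"
    and "p = card (pairs \<Gamma>)"
    and "p_hat = card {S \<in> pairs \<Gamma>. \<exists>i j. S = {i, j} \<and> inv' \<tau> i \<in> L_M \<and> inv' \<tau> j \<in> L_N}"
    and "f = card (free_set \<Gamma>)"
    and "f1 = card {i \<in> free_set \<Gamma>. inv' \<tau> i \<in> L_M}"
    and "f2 = f - f1"
  shows "B_group (complete_bipartite L_M L_N) (fixing_pattern \<Gamma>) \<tau>
           \<cong> sym_group_fixing n (split_pattern L_M L_N \<tau> (fixing_pattern \<Gamma>))
       \<and> order (B_group (complete_bipartite L_M L_N) (fixing_pattern \<Gamma>) \<tau>)
           = 2 ^ (p - p_hat) * fact f1 * fact f2"
proof -
  let ?F = "fixing_pattern \<Gamma>"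
  let ?A = "\<tau> ` L_M" and ?B = "\<tau> ` L_N"
  have \<tau>: "\<tau> permutes {1..n}" using assms(10) by (simp add: sym_group_carrier)
  have cover: "\<Union>?F = {1..n}" using Union_fixing_pattern[OF assms(8)] assms(9) by simp
  have img: "?A \<union> ?B = {1..n}" "?A \<inter> ?B = {}"
    using \<tau> assms(4,5) by (metis image_Un permutes_image, metis image_Int image_empty permutes_inj)
  have mem: "inv' \<tau> i \<in> C \<longleftrightarrow> i \<in> \<tau> ` C" for i C
    using inv_mem_iff_mem_image[OF permutes_bij[OF \<tau>]] .
  have iso: "B_group (complete_bipartite L_M L_N) ?F \<tau>
      \<cong> sym_group_fixing n (split_pattern L_M L_N \<tau> ?F)"
    using iso_conjugation[OF \<tau> assms(4,5) _ cover] assms(2,6,7) by (auto simp: is_iso_def)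
  have free: "card (free_set \<Gamma> \<inter> ?A) = f1" "card (free_set \<Gamma> \<inter> ?B) = f2"
  proof -
    show f1: "card (free_set \<Gamma> \<inter> ?A) = f1"
      unfolding assms(14) mem by (rule arg_cong[where f = card]) auto
    have sub: "free_set \<Gamma> \<subseteq> {1..n}" using free_set_eq[OF assms(8)] assms(9) by auto
    then have "finite (free_set \<Gamma>)" by (rule finite_subset) simp
    moreover have "free_set \<Gamma> \<inter> ?B = free_set \<Gamma> - free_set \<Gamma> \<inter> ?A" using sub img by auto
    ultimately show "card (free_set \<Gamma> \<inter> ?B) = f2"
      using f1 assms(13,15) by (simp add: card_Diff_subset)
  qed
  have ne: "?A \<noteq> {}" using assms(1,6) by auto
  have "carrier (sym_group_fixing n (split_pattern L_M L_N \<tau> ?F))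
      = {a. a permutes {1..n} \<and> (\<forall>S\<in>?F. a ` (S \<inter> ?A) = S \<inter> ?A \<and> a ` (S \<inter> ?B) = S \<inter> ?B)}"
    unfolding carrier_sym_group_fixing
    unfolding fixes_split_pattern_iff[OF finite_atLeastAtMost cover permutes_bij[OF \<tau>] img] ..
  then have "order (B_group (complete_bipartite L_M L_N) ?F \<tau>)
      = (\<Prod>S\<in>?F. fact (card (S \<inter> ?A)) * fact (card (S \<inter> ?B)))"
    using iso_same_card[OF iso] card_permutations_fixing_common_refinement[OF _ cover
      pairwise_disjnt_fixing_pattern[OF assms(8)] img ne]
    by (simp add: order_def)
  also have "\<dots> = (\<Prod>S\<in>pairs \<Gamma>. fact (card (S \<inter> ?A)) * fact (card (S \<inter> ?B)))
      * (fact (card (free_set \<Gamma> \<inter> ?A)) * fact (card (free_set \<Gamma> \<inter> ?B)))"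
  proof (rule prod_fixing_pattern[OF assms(8)])
    show "fact (card ({q} \<inter> ?A)) * fact (card ({q} \<inter> ?B)) = (1 :: nat)" for q
      by (simp add: Int_insert_left)
  qed simp
  also have "\<dots> = 2 ^ (p - p_hat) * fact f1 * fact f2"
    using prod_pairs[OF assms(8), of ?A ?B] img assms(9) free
    unfolding assms(11,12) mem by simp
  finally show ?thesis using iso by blast
qed

end
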